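(* Let $0<q<1$. For $u,v\in\mathbb{C}$, the reproducing kernel $K(u,v)=\sum_{n=0}^{\infty}P_{n}(u;q)P_{n}(v;q)$ of the orthogonal polynomials $P_{n}(x;q)$ is given by $$K(u,v)=\frac{1}{1-q}\;{}_{3}\phi_{3}\left[\begin{matrix}0, & u^{-1}vq, & uv^{-1}q\\ q^{3/2}, & -q^{3/2}, & -q\end{matrix}\ ;q, -uv \right].$$
   Context: Here $0<q<1$ and fractional powers of $q$ are positive reals. $(a;q)_{n}=\prod_{k=0}^{n-1}(1-aq^{k})$. The polynomials $P_n(x;q)$ are the orthonormal polynomials determined by $P_{0}(x;q)=1$, $P_1(x;q)=x$ and $$q^{-(n-1)/2}P_{n-1}(x;q)+q^{-n/2}P_{n+1}(x;q)=xP_{n}(x;q),\quad n\ge1.$$ Equivalently, $P_{n}(x;q)=(-\mathrm{i})^{n}q^{n(n+1)/4}\varphi_{n+1}(\mathrm{i}q^{-1/2}x;q^{-1})$, where $\varphi_0=0$, $\varphi_1=1$, $\varphi_{n+1}(x;q^{-1})=x\varphi_{n}(x;q^{-1})+q^{-(n-1)}\varphi_{n-1}(x;q^{-1})$ for $n\ge 1$. The basic hypergeometric series is $${}_{3}\phi_{3}\left[\begin{matrix}a_1,a_2,a_3\\ b_1,b_2,b_3\end{matrix};q,z\right]=\sum_{k=0}^{\infty}\frac{(a_1;q)_k(a_2;q)_k(a_3;q)_k}{(b_1;q)_k(b_2;q)_k(b_3;q)_k(q;q)_k}(-1)^kq^{k(k-1)/2}z^k .$$ When $u=0$ or $v=0$,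 the product $(u^{-1}vq;q)_k(uv^{-1}q;q)_k(uv)^k$ in each term is understood as the polynomial $\prod_{j=1}^{k}(u-vq^{j})(v-uq^{j})$ in $u,v$ (to which it is equal for $uv\neq0$). *)

theory Defs
  imports "HOL-Analysis.Analysis" "HOL-Computational_Algebra.Polynomial"
begin

definition q_poch :: "complex \<Rightarrow> complex \<Rightarrow> nat \<Rightarrow> complex" where
  "q_poch a q n = (\<Prod>k<n. 1 - a * q ^ k)"

definition phi33_term :: "complex \<Rightarrow> complex \<Rightarrow> complex \<Rightarrow> complex \<Rightarrow> complex \<Rightarrow> complex
    \<Rightarrow> complex \<Rightarrow> complex \<Rightarrow> nat \<Rightarrow> complex" where
  "phi33_term a1 a2 a3 b1 b2 b3 q z k =
     (q_poch a1 q k * q_poch a2 q k * q_poch a3 q k) /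
     (q_poch b1 q k * q_poch b2 q k * q_poch b3 q k * q_poch q q k)
     * (-1) ^ k * q ^ (k * (k - 1) div 2) * z ^ k"

definition phi33 :: "complex \<Rightarrow> complex \<Rightarrow> complex \<Rightarrow> complex \<Rightarrow> complex \<Rightarrow> complex
    \<Rightarrow> complex \<Rightarrow> complex \<Rightarrow> complex" where
  "phi33 a1 a2 a3 b1 b2 b3 q z = (\<Sum>k. phi33_term a1 a2 a3 b1 b2 b3 q z k)"

text \<open>The three-term recurrence
  \<open>q\<^bsup>-(n-1)/2\<^esup> P\<^bsub>n-1\<^esub> + q\<^bsup>-n/2\<^esup> P\<^bsub>n+1\<^esub> = x P\<^bsub>n\<^esub>\<close> (\<open>n \<ge> 1\<close>),
  solved for its highest term; the lemma \<open>orth_P_recurrence\<close> gives the original form.\<close>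

fun orth_P :: "real \<Rightarrow> nat \<Rightarrow> complex poly" where
  "orth_P q 0 = 1"
| "orth_P q (Suc 0) = [:0, 1:]"
| "orth_P q (Suc (Suc n)) =
     smult (of_real (q powr (real (Suc n) / 2)))
       ([:0, 1:] * orth_P q (Suc n) - smult (of_real (q powr (- real n / 2))) (orth_P q n))"

lemma orth_P_recurrence:
  assumes "0 < q" "n \<ge> 1"
  shows "smult (of_real (q powr (- (real n - 1) / 2))) (orth_P q (n - 1))
       + smult (of_real (q powr (- real n / 2))) (orth_P q (n + 1)) = [:0, 1:] * orth_P q n"
proof -
  obtain m where n: "n = Suc m" using assms(2) by (cases n) auto
  have "- real n / 2 + real (Suc m) / 2 = 0"
    by (simp add: n field_simps)
  then have "q powr (- real n / 2) * q powr (real (Suc m) / 2) = 1"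
    using assms(1) by (metis powr_add powr_zero_eq_one less_irrefl)
  then have "complex_of_real (q powr (- real n / 2)) * of_real (q powr (real (Suc m) / 2)) = 1"
    by (metis of_real_mult of_real_1)
  then have "smult (of_real (q powr (- real n / 2))) (orth_P q (n + 1))
      = [:0, 1:] * orth_P q n - smult (of_real (q powr (- real m / 2))) (orth_P q m)"
    by (simp add: n del: of_real_mult)
  then show ?thesis by (simp add: n)
qed

definition repr_kernel :: "real \<Rightarrow> complex \<Rightarrow> complex \<Rightarrow> complex" where
  "repr_kernel q u v = (\<Sum>n. poly (orth_P q n) u * poly (orth_P q n) v)"

text \<open>The \<open>k\<close>-th term of the \<open>\<^sub>3\<phi>\<^sub>3\<close> series with numerator parameters
  \<open>0, u\<^sup>-\<^sup>1vq, uv\<^sup>-\<^sup>1q\<close>, denominator parameters \<open>q\<^bsup>3/2\<^esup>, -q\<^bsup>3/2\<^esup>, -q\<close> and argument \<open>-uv\<close>,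
  in which \<open>(u\<^sup>-\<^sup>1vq;q)\<^sub>k (uv\<^sup>-\<^sup>1q;q)\<^sub>k (uv)\<^sup>k\<close> is written as a polynomial in \<open>u, v\<close>.
  This is what the series means when \<open>u = 0\<close> or \<open>v = 0\<close>, where division by zero
  makes \<open>phi33_term\<close> useless.\<close>

definition kernel_phi33_term :: "real \<Rightarrow> complex \<Rightarrow> complex \<Rightarrow> nat \<Rightarrow> complex" where
  "kernel_phi33_term q u v k =
     (q_poch 0 (of_real q) k
        * (\<Prod>j=1..k. (u - v * of_real q ^ j) * (v - u * of_real q ^ j))) /
     (q_poch (of_real (q powr (3/2))) (of_real q) k
        * q_poch (- of_real (q powr (3/2))) (of_real q) k
        * q_poch (- of_real q) (of_real q) k * q_poch (of_real q) (of_real q) k)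
     * (-1) ^ k * of_real q ^ (k * (k - 1) div 2) * (-1) ^ k"

lemma kernel_phi33_term_eq:
  assumes "u \<noteq> 0" "v \<noteq> 0"
  shows "kernel_phi33_term q u v k =
    phi33_term 0 (inverse u * v * of_real q) (u * inverse v * of_real q)
      (of_real (q powr (3/2))) (- of_real (q powr (3/2))) (- of_real q) (of_real q) (- (u * v)) k"
proof -
  have poly: "(\<Prod>j=1..k. (u - v * of_real q ^ j) * (v - u * of_real q ^ j))
      = q_poch (inverse u * v * of_real q) (of_real q) k
        * q_poch (u * inverse v * of_real q) (of_real q) k * (u * v) ^ k"
  proof (induction k)
    case 0
    then show ?case by (simp add: q_poch_def)
  next
    case (Suc k)
    have "(u - v * of_real q ^ Suc k) * (v - u * of_real q ^ Suc k)
        = (1 - inverse u * v * of_real q * of_real q ^ k)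
          * (1 - u * inverse v * of_real q * of_real q ^ k) * (u * v)"
      using assms by (simp add: field_simps)
    with Suc show ?case by (simp add: q_poch_def mult_ac)
  qed
  have "(- (u * v)) ^ k = (-1) ^ k * (u * v) ^ k"
    by (rule power_minus)
  then show ?thesis
    unfolding kernel_phi33_term_def phi33_term_def poly by (simp add: mult_ac)
qed

end

theory Submission
  imports Defs
begin

text \<open>
  Multiplied by \<open>u - v\<close>, both sides of the formula become the same combination
  \<open>B u * D v - D u * B v\<close> of two entire functions.

  On the kernel side this is the Christoffel--Darboux formula. The polynomials of even and of odd
  index, divided by \<open>(-1)^n * q powr (n/2)\<close>, satisfy the first-order system
  \<open>E (n+1) = E n - q^n * x * O n\<close>, \<open>O (n+1) = O n + q^(n+1) * x * E (n+1)\<close>, so that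
  \<open>(u - v)\<close> times the sum of the first \<open>2n+1\<close> products \<open>P i u * P i v\<close> is exactly
  \<open>O n u * E n v - E n u * O n v\<close> (\<open>Christoffel_Darboux_red\<close>). The same system shows that the
  coefficients of \<open>E n\<close> and \<open>O n\<close> are, up to sign, powers of \<open>q\<close> times Gaussian binomials
  (\<open>even_odd_red_explicit\<close>). As \<open>n\<close> grows, a binomial with lower index \<open>k\<close> tends to
  \<open>1 / (q;q)\<^sub>k\<close> without exceeding that limit, so by Tannery's theorem \<open>E n\<close> and \<open>O n\<close> converge to
  the explicit power series
  \<open>D = suminf (even_term q _)\<close> and \<open>B = suminf (odd_term q _)\<close>.

  On the hypergeometric side, the four denominator factors of the \<open>k\<close>-th term combine to
  \<open>(q;q)\<^sub>2\<^sub>k\<^sub>+\<^sub>1 / (1 - q)\<close> (\<open>q_poch_denominator\<close>). The extra factor \<open>u - v\<close> fills the gap at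
  \<open>j = 0\<close> in the two products of \<open>u - v * q^j\<close> and \<open>v - u * q^j\<close>, so that together they form
  one product of \<open>2k+1\<close> factors in geometric progression. The finite \<open>q\<close>-binomial theorem expands
  it into monomials \<open>u^a * v^b\<close> with \<open>a + b = 2k+1\<close>, and the exponent of \<open>q\<close> in the coefficient
  splits into a part depending on \<open>a\<close> alone and a part depending on \<open>b\<close> alone. Hence the
  \<open>k\<close>-th term is the \<open>k\<close>-th diagonal of the Cauchy products in \<open>B u * D v - D u * B v\<close>
  (\<open>kernel_term_expansion\<close>).

  Cancelling \<open>u - v\<close> proves the formula for \<open>u \<noteq> v\<close>. Both sides are locally uniform limits of
  continuous functions of \<open>u\<close>, so it extends to \<open>u = v\<close>.
\<close>

section \<open>Gaussian binomials\<close>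

fun gauss_binom :: "real \<Rightarrow> nat \<Rightarrow> nat \<Rightarrow> real" where
  "gauss_binom q n 0 = 1"
| "gauss_binom q 0 (Suc k) = 0"
| "gauss_binom q (Suc n) (Suc k) = gauss_binom q n (Suc k) + q ^ (n - k) * gauss_binom q n k"

text \<open>
  The real sequence \<open>(q;q)\<^sub>n\<close>. It is kept separate from the complex \<open>q_poch\<close> because the
  estimates below compare such products by size.\<close>

definition qq_poch :: "real \<Rightarrow> nat \<Rightarrow> real" where
  "qq_poch q n = (\<Prod>i<n. 1 - q ^ Suc i)"

lemma qq_poch_0 [simp]: "qq_poch q 0 = 1"
  by (simp add: qq_poch_def)

lemma qq_poch_Suc: "qq_poch q (Suc n) = qq_poch q n * (1 - q ^ Suc n)"
  by (simp add: qq_poch_def)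

lemma gauss_binom_eq_0: "n < k \<Longrightarrow> gauss_binom q n k = 0"
  by (induction q n k rule: gauss_binom.induct) auto

lemma gauss_binom_diag [simp]: "gauss_binom q n n = 1"
  by (induction n) (auto simp: gauss_binom_eq_0)

text \<open>
  The closed form, with denominators cleared: the induction step combines the two
  binomials of the Pascal rule by \<open>(1 - q^(m+1)) + q^(m+1) * (1 - q^(k+1)) = 1 - q^(m+k+2)\<close>.\<close>

lemma gauss_binom_qq_poch:
  "k \<le> n \<Longrightarrow> gauss_binom q n k * (qq_poch q k * qq_poch q (n - k)) = qq_poch q n"
proof (induction q n k rule: gauss_binom.induct)
  case (3 q n k)
  show ?case
  proof (cases "k = n")
    case False
    with 3(3) have kn: "Suc k \<le> n" by simp
    define m where "m = n - Suc k"
    have nk: "n - k = Suc m" and n: "n = Suc m + k" using kn by (auto simp: m_def)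
    have IH1: "gauss_binom q n (Suc k) * (qq_poch q (Suc k) * qq_poch q m) = qq_poch q n"
      using 3(1)[OF kn] by (simp add: m_def)
    have IH2: "gauss_binom q n k * (qq_poch q k * qq_poch q (Suc m)) = qq_poch q n"
      using 3(2) kn by (simp add: nk)
    have "gauss_binom q (Suc n) (Suc k) * (qq_poch q (Suc k) * qq_poch q (Suc n - Suc k))
      = (gauss_binom q n (Suc k) * (qq_poch q (Suc k) * qq_poch q m)) * (1 - q ^ Suc m)
        + q ^ Suc m * (1 - q ^ Suc k) * (gauss_binom q n k * (qq_poch q k * qq_poch q (Suc m)))"
      by (simp add: nk qq_poch_Suc algebra_simps)
    also have "\<dots> = qq_poch q n * ((1 - q ^ Suc m) + q ^ Suc m * (1 - q ^ Suc k))"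
      unfolding IH1 IH2 by (simp add: algebra_simps)
    also have "\<dots> = qq_poch q (Suc n)"
      by (simp add: qq_poch_Suc n power_add algebra_simps)
    finally show ?thesis .
  qed auto
qed auto

context
  fixes q :: real
  assumes q: "0 < q" "q < 1"
begin

lemma q_Suc_bounds: "0 < 1 - q ^ Suc i" "1 - q ^ Suc i \<le> 1" "1 - q \<le> 1 - q ^ Suc i"
  using q power_Suc_less_one[of q i] power_le_one[of q i]
  by (auto simp del: power_Suc) (auto simp: mult_left_le)

lemma qq_poch_pos: "0 < qq_poch q n"
  unfolding qq_poch_def by (intro prod_pos) (use q_Suc_bounds in auto)

lemma qq_poch_decreasing: "qq_poch q (n + k) \<le> qq_poch q n"
proof (induction k)
  case (Suc k)
  have "qq_poch q (Suc (n + k)) \<le> qq_poch q (n + k)"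
    unfolding qq_poch_Suc using qq_poch_pos q_Suc_bounds by (intro mult_left_le) (auto intro: less_imp_le)
  with Suc show ?case by simp
qed simp

lemma gauss_binom_nonneg: "0 \<le> gauss_binom q n k"
proof (cases "k \<le> n")
  case True
  then show ?thesis using gauss_binom_qq_poch[OF True, of q] qq_poch_pos
    by (metis mult_pos_pos zero_less_mult_pos2 less_imp_le)
qed (simp add: gauss_binom_eq_0)

text \<open>
  For \<open>0 < q < 1\<close> the quotient \<open>(q;q)\<^sub>n / (q;q)\<^sub>n\<^sub>-\<^sub>k\<close> is a product of \<open>k\<close> numbers
  strictly between \<open>0\<close> and \<open>1\<close>, each tending to \<open>1\<close> as \<open>n\<close> grows. This gives the bound that is uniform in \<open>n\<close>,
  and also the limit.\<close>

lemma gauss_binom_le: "gauss_binom q n k \<le> 1 / qq_poch q k"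
proof (cases "k \<le> n")
  case True
  have "gauss_binom q n k * qq_poch q k * qq_poch q (n - k) \<le> 1 * qq_poch q (n - k)"
    using gauss_binom_qq_poch[OF True, of q] qq_poch_decreasing[of "n - k" k] True by (simp add: mult_ac)
  then have "gauss_binom q n k * qq_poch q k \<le> 1"
    using qq_poch_pos mult_le_cancel_right_pos by blast
  then show ?thesis using qq_poch_pos by (simp add: field_simps)
qed (use qq_poch_pos in \<open>simp add: gauss_binom_eq_0 less_imp_le\<close>)

lemma gauss_binom_LIMSEQ: "(\<lambda>n. gauss_binom q n k) \<longlonglongrightarrow> 1 / qq_poch q k"
proof -
  have lim: "(\<lambda>n. (\<Prod>i<k. 1 - q ^ (n + Suc i))) \<longlonglongrightarrow> (\<Prod>i<k. 1 - 0)"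
    by (intro tendsto_intros LIMSEQ_ignore_initial_segment LIMSEQ_power_zero) (use q in auto)
  have "gauss_binom q (n + k) k = (\<Prod>i<k. 1 - q ^ (n + Suc i)) / qq_poch q k" for n
  proof -
    have "qq_poch q (n + k) = qq_poch q n * (\<Prod>i<k. 1 - q ^ (n + Suc i))"
      by (induction k) (simp_all add: qq_poch_Suc mult_ac)
    with gauss_binom_qq_poch[of k "n + k" q] have "gauss_binom q (n + k) k * qq_poch q k = (\<Prod>i<k. 1 - q ^ (n + Suc i))"
      using qq_poch_pos[of n] by (simp add: mult_ac) 
    then show ?thesis using qq_poch_pos[of k] by (simp add: field_simps)
  qed
  then have "(\<lambda>n. gauss_binom q (n + k) k) \<longlonglongrightarrow> (\<Prod>i<k. 1 - 0) / qq_poch q k"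
    using tendsto_divide[OF lim tendsto_const[of "qq_poch q k"]] qq_poch_pos[of k] by simp
  then show ?thesis by (simp add: LIMSEQ_offset)
qed

text \<open>
  The dominating series below have term ratios of order \<open>q^n\<close>; such ratios are
  eventually below \<open>1/2\<close>, whatever the constant in front.\<close>

lemma summable_if_ratio_le_geometric:
  fixes f :: "nat \<Rightarrow> 'a :: banach"
  assumes "\<And>n. norm (f (Suc n)) \<le> C * q ^ n * norm (f n)"
  shows "summable f"
proof -
  have "(\<lambda>n. C * q ^ n) \<longlonglongrightarrow> C * 0"
    by (intro tendsto_intros LIMSEQ_power_zero) (use q in auto)
  then have "\<forall>\<^sub>F n in sequentially. C * q ^ n < 1 / 2"
    by (rule order_tendstoD) simp
  then obtain N where N: "\<And>n. n \<ge> N \<Longrightarrow> C * q ^ n < 1 / 2"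
    by (auto simp: eventually_sequentially)
  show ?thesis
  proof (rule summable_ratio_test[of "1/2" N])
    fix n assume "N \<le> n"
    then have "C * q ^ n * norm (f n) \<le> 1 / 2 * norm (f n)"
      using N by (intro mult_right_mono) (auto intro: less_imp_le)
    with assms[of n] show "norm (f (Suc n)) \<le> 1 / 2 * norm (f n)" by linarith
  qed simp
qed

end

text \<open>
  The finite \<open>q\<close>-binomial theorem, homogeneous in \<open>x\<close> and \<open>y\<close>. Multiplying the expansion for \<open>n\<close>
  by the next factor \<open>x - y * q^n\<close> turns the coefficients into those for \<open>n + 1\<close> by the Pascal
  rule that defines \<open>gauss_binom\<close>.\<close>

lemma q_binomial:
  fixes x y :: complex
  shows "(\<Prod>j<n. x - y * of_real q ^ j)
    = (\<Sum>b\<le>n. of_real ((-1) ^ b * q ^ (b * (b - 1) div 2) * gauss_binom q n b) * x ^ (n - b) * y ^ b)"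
proof (induction n)
  case (Suc n)
  define c where "c n b = (complex_of_real ((-1) ^ b * q ^ (b * (b - 1) div 2) * gauss_binom q n b))" for n b
  have c0: "c n 0 = 1" for n by (simp add: c_def)
  have cS: "c (Suc n) (Suc b) = c n (Suc b) - of_real q ^ n * c n b" for b
  proof (cases "b \<le> n")
    case True
    have "Suc b * b = b * (b - 1) + b * 2"
      by (cases b) auto
    then have "Suc b * b div 2 = b * (b - 1) div 2 + b"
      by simp
    then have "Suc b * b div 2 + (n - b) = n + b * (b - 1) div 2"
      using True by linarith
    then have pow: "q ^ (Suc b * b div 2) * q ^ (n - b) = q ^ n * q ^ (b * (b - 1) div 2)"
      by (metis power_add)
    have "(-1) ^ Suc b * q ^ (Suc b * b div 2) * gauss_binom q (Suc n) (Suc b)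
       = (-1) ^ Suc b * q ^ (Suc b * b div 2) * gauss_binom q n (Suc b)
         - (-1) ^ b * (q ^ (Suc b * b div 2) * q ^ (n - b)) * gauss_binom q n b"
      by (simp add: distrib_left mult_ac del: mult_Suc)
    also have "\<dots> = (-1) ^ Suc b * q ^ (Suc b * b div 2) * gauss_binom q n (Suc b)
         - q ^ n * ((-1) ^ b * q ^ (b * (b - 1) div 2) * gauss_binom q n b)"
      unfolding pow by (simp only: mult_ac)
    finally show ?thesis unfolding c_def
      by (simp only: diff_Suc_1 of_real_diff of_real_mult of_real_power)
  qed (simp add: c_def gauss_binom_eq_0)
  have "(\<Prod>j<Suc n. x - y * of_real q ^ j)
      = (x - y * of_real q ^ n) * (\<Sum>b\<le>n. c n b * x ^ (n - b) * y ^ b)"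
    by (simp add: Suc c_def mult_ac)
  also have "\<dots> = (\<Sum>b\<le>n. c n b * x ^ (Suc n - b) * y ^ b)
       - (\<Sum>b\<le>n. of_real q ^ n * c n b * x ^ (n - b) * y ^ Suc b)"
    unfolding left_diff_distrib sum_distrib_left by (simp add: Suc_diff_le sum_subtractf mult_ac)
  also have "(\<Sum>b\<le>n. c n b * x ^ (Suc n - b) * y ^ b) = (\<Sum>b\<le>Suc n. c n b * x ^ (Suc n - b) * y ^ b)"
    by (simp add: c_def gauss_binom_eq_0)
  also have "\<dots> = x ^ Suc n + (\<Sum>b\<le>n. c n (Suc b) * x ^ (n - b) * y ^ Suc b)"
    by (subst sum.atMost_Suc_shift) (simp add: c0)
  also have "x ^ Suc n + (\<Sum>b\<le>n. c n (Suc b) * x ^ (n - b) * y ^ Suc b)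
       - (\<Sum>b\<le>n. of_real q ^ n * c n b * x ^ (n - b) * y ^ Suc b)
     = x ^ Suc n + (\<Sum>b\<le>n. c (Suc n) (Suc b) * x ^ (n - b) * y ^ Suc b)"
    unfolding cS left_diff_distrib sum_subtractf by (simp add: mult_ac)
  also have "\<dots> = (\<Sum>b\<le>Suc n. c (Suc n) b * x ^ (Suc n - b) * y ^ b)"
    by (subst sum.atMost_Suc_shift) (simp add: c0)
  finally show ?case unfolding c_def .
qed simp

section \<open>The polynomials of even and of odd index\<close>

text \<open>
  The recurrence makes \<open>poly (orth_P q m) x\<close> decay like \<open>q powr (m/4)\<close>, with alternating signs
  along each parity class. Dividing by \<open>(-1)^n * q powr (n/2)\<close> leaves sequences that converge to
  entire functions of \<open>x\<close> that are not identically zero.\<close>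

definition even_red :: "real \<Rightarrow> nat \<Rightarrow> complex \<Rightarrow> complex" where
  "even_red q n x = of_real ((-1) ^ n * q powr (- real n / 2)) * poly (orth_P q (2 * n)) x"

definition odd_red :: "real \<Rightarrow> nat \<Rightarrow> complex \<Rightarrow> complex" where
  "odd_red q n x = of_real ((-1) ^ n * q powr (- real n / 2)) * poly (orth_P q (Suc (2 * n))) x"

lemma even_red_0 [simp]: "even_red q 0 x = 1" if "q > 0"
  using that by (simp add: even_red_def)

lemma odd_red_0 [simp]: "odd_red q 0 x = x" if "q > 0"
  using that by (simp add: odd_red_def)

text \<open>
  After the rescaling, the three-term recurrence becomes a first-order system for the pair
  of sequences, in which each step is a perturbation of size \<open>q^n\<close>.\<close>

lemma even_red_Suc:
  assumes "q > 0"
  shows "even_red q (Suc n) x = even_red q n x - of_real (q ^ n) * x * odd_red q n x"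
proof -
  have 1: "q powr (- real (Suc n) / 2) * q powr (real (Suc (2 * n)) / 2) = q ^ n * q powr (- real n / 2)"
    using assms by (simp add: powr_realpow[symmetric] powr_add[symmetric] field_simps)
  have 2: "q ^ n * q powr (- real (2 * n) / 2) = 1"
    using assms by (simp add: powr_realpow[symmetric] powr_add[symmetric])
  have "even_red q (Suc n) x
      = of_real ((-1) ^ Suc n * (q powr (- real (Suc n) / 2) * q powr (real (Suc (2 * n)) / 2)))
        * (x * poly (orth_P q (Suc (2 * n))) x
          - of_real (q powr (- real (2 * n) / 2)) * poly (orth_P q (2 * n)) x)"
    unfolding even_red_def by (simp add: mult_ac)
  also have "\<dots> = of_real ((-1) ^ n * q powr (- real n / 2) * (q ^ n * q powr (- real (2 * n) / 2)))
          * poly (orth_P q (2 * n)) x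
        - of_real (q ^ n) * x * odd_red q n x"
    unfolding 1 odd_red_def by (simp add: algebra_simps)
  finally show ?thesis unfolding 2 even_red_def by simp
qed

lemma odd_red_Suc:
  assumes "q > 0"
  shows "odd_red q (Suc n) x = odd_red q n x + of_real (q ^ Suc n) * x * even_red q (Suc n) x"
proof -
  have 1: "q powr (real (Suc (Suc (2 * n))) / 2) = q ^ Suc n"
    using assms by (simp add: powr_realpow[symmetric] add_divide_distrib del: power_Suc)
  have 2: "q powr (- real (Suc n) / 2) * q ^ Suc n * q powr (- real (Suc (2 * n)) / 2) = q powr (- real n / 2)"
    using assms by (simp add: powr_realpow[symmetric] powr_add[symmetric] field_simps del: power_Suc)
  have "odd_red q (Suc n) x
      = of_real ((-1) ^ Suc n * q powr (- real (Suc n) / 2) * q powr (real (Suc (Suc (2 * n))) / 2))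
        * (x * poly (orth_P q (2 * Suc n)) x
          - of_real (q powr (- real (Suc (2 * n)) / 2)) * poly (orth_P q (Suc (2 * n))) x)"
    unfolding odd_red_def mult_Suc_right add_2_eq_Suc orth_P.simps(3)[of q "Suc (2 * n)"]
    by (simp add: mult_ac del: orth_P.simps)
  also have "\<dots> = of_real ((-1) ^ n * (q powr (- real (Suc n) / 2) * q ^ Suc n * q powr (- real (Suc (2 * n)) / 2)))
          * poly (orth_P q (Suc (2 * n))) x
        + of_real (q ^ Suc n) * x * even_red q (Suc n) x"
    unfolding 1 even_red_def by (simp add: algebra_simps del: orth_P.simps)
  finally show ?thesis unfolding 2 odd_red_def by simp
qed

lemma red_scale_sq:
  assumes "q > 0"
  shows "complex_of_real (q ^ n) * (of_real ((-1) ^ n * q powr (- real n / 2))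
    * of_real ((-1) ^ n * q powr (- real n / 2))) = 1"
proof -
  have "q powr (- real n / 2) * q powr (- real n / 2) = q powr (- real n)"
    by (simp flip: powr_add)
  then have "q ^ n * (((-1) ^ n * q powr (- real n / 2)) * ((-1) ^ n * q powr (- real n / 2))) = 1"
    using assms by (cases "even n") (simp_all add: powr_realpow[symmetric] powr_add[symmetric])
  then show ?thesis
    by (metis of_real_mult of_real_1)
qed

lemma orth_P_even_prod:
  assumes "q > 0"
  shows "poly (orth_P q (2 * n)) u * poly (orth_P q (2 * n)) v
    = of_real (q ^ n) * (even_red q n u * even_red q n v)"
proof -
  have "a * (r * x * (r * y)) = a * (r * r) * (x * y)" for a r x y :: complex
    by (simp only: mult_ac)
  then show ?thesis
    unfolding even_red_def by (simp only: red_scale_sq[OF assms] mult_1)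
qed

lemma orth_P_odd_prod:
  assumes "q > 0"
  shows "poly (orth_P q (Suc (2 * n))) u * poly (orth_P q (Suc (2 * n))) v
    = of_real (q ^ n) * (odd_red q n u * odd_red q n v)"
proof -
  have "a * (r * x * (r * y)) = a * (r * r) * (x * y)" for a r x y :: complex
    by (simp only: mult_ac)
  then show ?thesis
    unfolding odd_red_def by (simp only: red_scale_sq[OF assms] mult_1)
qed

text \<open>
  Substituting the first-order system for the new values raises the right-hand side by
  \<open>(u - v) * q^n * O n u * O n v\<close> and by \<open>(u - v) * q^(n+1) * E (n+1) u * E (n+1) v\<close>, where \<open>E\<close> and
  \<open>O\<close> are the rescaled polynomials. These are \<open>u - v\<close> times the two new products of the sum.\<close>

lemma Christoffel_Darboux_red:
  assumes "q > 0"
  shows "(u - v) * (\<Sum>i<Suc (2 * n). poly (orth_P q i) u * poly (orth_P q i) v)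
    = odd_red q n u * even_red q n v - even_red q n u * odd_red q n v"
proof (induction n)
  case 0
  then show ?case using assms by simp
next
  case (Suc n)
  have "(\<Sum>i<Suc (2 * Suc n). poly (orth_P q i) u * poly (orth_P q i) v)
     = (\<Sum>i<Suc (2 * n). poly (orth_P q i) u * poly (orth_P q i) v)
       + of_real (q ^ n) * (odd_red q n u * odd_red q n v)
       + of_real (q ^ Suc n) * (even_red q (Suc n) u * even_red q (Suc n) v)"
    unfolding orth_P_even_prod[OF assms, symmetric] orth_P_odd_prod[OF assms, symmetric]
    by (simp only: sum.lessThan_Suc mult_Suc_right add_2_eq_Suc)
  then have "(u - v) * (\<Sum>i<Suc (2 * Suc n). poly (orth_P q i) u * poly (orth_P q i) v)
     = odd_red q n u * even_red q n v - even_red q n u * odd_red q n v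
       + (u - v) * (of_real (q ^ n) * (odd_red q n u * odd_red q n v))
       + (u - v) * (of_real (q ^ Suc n) * (even_red q (Suc n) u * even_red q (Suc n) v))"
    by (simp only: distrib_left Suc)
  also have "\<dots> = odd_red q n u * even_red q (Suc n) v - even_red q (Suc n) u * odd_red q n v
       + (u - v) * (of_real (q ^ Suc n) * (even_red q (Suc n) u * even_red q (Suc n) v))"
    unfolding even_red_Suc[OF assms] by (simp add: algebra_simps del: of_real_power power_Suc)
  also have "\<dots> = odd_red q (Suc n) u * even_red q (Suc n) v - even_red q (Suc n) u * odd_red q (Suc n) v"
    unfolding odd_red_Suc[OF assms] by (simp add: algebra_simps del: of_real_power power_Suc)
  finally show ?case .
qed

text \<open>
  Comparing coefficients in the first-order system gives exactly the Pascal rule for the Gaussian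
  binomials. The summation bound \<open>N\<close> may be any number from \<open>n\<close> on, since the surplus
  binomials vanish; this freedom lets the sums for \<open>n\<close> and \<open>n + 1\<close> run over the same range.
  Both identities are proved together because the system couples them.\<close>

lemma even_odd_red_explicit:
  assumes "q > 0"
  shows "n \<le> N \<Longrightarrow> even_red q n x
      = (\<Sum>t\<le>N. of_real ((-1) ^ t * q ^ (t * (t - 1)) * gauss_binom q (n + t) (2 * t)) * x ^ (2 * t))
    \<and> odd_red q n x
      = (\<Sum>t\<le>N. of_real ((-1) ^ t * q ^ (t * t) * gauss_binom q (Suc (n + t)) (Suc (2 * t))) * x ^ Suc (2 * t))"
proof (induction n arbitrary: N)
  case 0
  have "(\<Sum>t\<le>N. of_real ((-1) ^ t * q ^ (t * (t - 1)) * gauss_binom q (0 + t) (2 * t)) * x ^ (2 * t))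
     = (\<Sum>t\<in>{0}. of_real ((-1) ^ t * q ^ (t * (t - 1)) * gauss_binom q (0 + t) (2 * t)) * x ^ (2 * t))"
    by (rule sum.mono_neutral_right) (auto simp: gauss_binom_eq_0)
  moreover have "(\<Sum>t\<le>N. of_real ((-1) ^ t * q ^ (t * t) * gauss_binom q (Suc (0 + t)) (Suc (2 * t))) * x ^ Suc (2 * t))
     = (\<Sum>t\<in>{0}. of_real ((-1) ^ t * q ^ (t * t) * gauss_binom q (Suc (0 + t)) (Suc (2 * t))) * x ^ Suc (2 * t))"
    by (rule sum.mono_neutral_right) (auto simp: gauss_binom_eq_0)
  ultimately show ?case
    using assms by simp_all
next
  case (Suc n)
  define a where "a n t = (-1) ^ t * q ^ (t * (t - 1)) * gauss_binom q (n + t) (2 * t)" for n t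
  define b where "b n t = (-1) ^ t * q ^ (t * t) * gauss_binom q (Suc (n + t)) (Suc (2 * t))" for n t
  have a0: "a m 0 = 1" for m by (simp add: a_def)
  have aS: "a (Suc n) (Suc t) = a n (Suc t) - q ^ n * b n t" for t
  proof (cases "t \<le> n")
    case True
    then have e: "Suc t * t + (n - t) = n + t * t" by simp
    have g: "gauss_binom q (Suc n + Suc t) (2 * Suc t)
        = gauss_binom q (n + Suc t) (2 * Suc t) + q ^ (n - t) * gauss_binom q (Suc (n + t)) (Suc (2 * t))"
      by simp
    have "q ^ (Suc t * t) * q ^ (n - t) = q ^ n * q ^ (t * t)"
      using e by (metis power_add)
    then show ?thesis unfolding a_def b_def g
      by (simp add: distrib_left mult_ac del: mult_Suc gauss_binom.simps mult_Suc_right)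
  qed (simp add: a_def b_def gauss_binom_eq_0)
  have bS: "b (Suc n) t = b n t + q ^ Suc n * a (Suc n) t" for t
  proof (cases "t \<le> Suc n")
    case True
    then have e: "t * t + (Suc n - t) = Suc n + t * (t - 1)" by (cases t) auto
    have g: "gauss_binom q (Suc (Suc n + t)) (Suc (2 * t))
        = gauss_binom q (Suc (n + t)) (Suc (2 * t)) + q ^ (Suc n - t) * gauss_binom q (Suc n + t) (2 * t)"
      by simp
    have "q ^ (t * t) * q ^ (Suc n - t) = q ^ Suc n * q ^ (t * (t - 1))"
      using e by (metis power_add)
    then show ?thesis unfolding a_def b_def g
      by (simp add: distrib_left mult_ac del: mult_Suc gauss_binom.simps mult_Suc_right power_Suc)
  qed (simp add: a_def b_def gauss_binom_eq_0 del: gauss_binom.simps)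
  have even: "even_red q (Suc n) x = (\<Sum>t\<le>N. of_real (a (Suc n) t) * x ^ (2 * t))" if le: "Suc n \<le> N" for N
  proof -
    obtain M where N: "N = Suc M" and M: "n \<le> M" using le by (cases N) auto
    have "even_red q (Suc n) x = (\<Sum>t\<le>Suc M. of_real (a n t) * x ^ (2 * t))
        - of_real (q ^ n) * x * (\<Sum>t\<le>M. of_real (b n t) * x ^ Suc (2 * t))"
      using Suc.IH[of "Suc M"] Suc.IH[of M] M even_red_Suc[OF assms] by (simp add: a_def b_def)
    also have "\<dots> = 1 + (\<Sum>t\<le>M. of_real (a n (Suc t)) * x ^ (2 * Suc t))
        - (\<Sum>t\<le>M. of_real (q ^ n * b n t) * x ^ (2 * Suc t))"
      by (subst sum.atMost_Suc_shift) (simp add: a0 sum_distrib_left mult_ac)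
    also have "\<dots> = 1 + (\<Sum>t\<le>M. of_real (a (Suc n) (Suc t)) * x ^ (2 * Suc t))"
      unfolding aS of_real_diff left_diff_distrib sum_subtractf by simp
    also have "\<dots> = (\<Sum>t\<le>N. of_real (a (Suc n) t) * x ^ (2 * t))"
      unfolding N by (subst sum.atMost_Suc_shift) (simp add: a0)
    finally show ?thesis .
  qed
  have "odd_red q (Suc n) x = (\<Sum>t\<le>N. of_real (b (Suc n) t) * x ^ Suc (2 * t))" if "Suc n \<le> N" for N
  proof -
    have "odd_red q (Suc n) x = (\<Sum>t\<le>N. of_real (b n t) * x ^ Suc (2 * t))
        + of_real (q ^ Suc n) * x * (\<Sum>t\<le>N. of_real (a (Suc n) t) * x ^ (2 * t))"
      using Suc.IH[of N] that even[OF that] odd_red_Suc[OF assms] by (simp add: b_def)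
    also have "\<dots> = (\<Sum>t\<le>N. of_real (b (Suc n) t) * x ^ Suc (2 * t))"
      unfolding bS of_real_add distrib_right sum.distrib by (simp add: sum_distrib_left mult_ac)
    finally show ?thesis .
  qed
  then show ?case using even Suc.prems by (simp only: a_def b_def)
qed

section \<open>Expansion of the terms of the kernel series\<close>

text \<open>
  The terms of the power series of the two limit functions; only even, respectively odd, powers
  occur, and \<open>t\<close> counts them.\<close>

definition even_term :: "real \<Rightarrow> complex \<Rightarrow> nat \<Rightarrow> complex" where
  "even_term q x t = of_real ((-1) ^ t * q ^ (t * (t - 1)) / qq_poch q (2 * t)) * x ^ (2 * t)"

definition odd_term :: "real \<Rightarrow> complex \<Rightarrow> nat \<Rightarrow> complex" where
  "odd_term q x t = of_real ((-1) ^ t * q ^ (t * t) / qq_poch q (Suc (2 * t))) * x ^ Suc (2 * t)"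

text \<open>
  The term of the basic hypergeometric series with the factor \<open>1 / (1 - q)\<close> already included,
  which completes its denominator to \<open>(q;q)\<^sub>2\<^sub>k\<^sub>+\<^sub>1\<close>.\<close>

definition kernel_term :: "real \<Rightarrow> complex \<Rightarrow> complex \<Rightarrow> nat \<Rightarrow> complex" where
  "kernel_term q u v k = of_real (q ^ (k * (k - 1) div 2) / qq_poch q (Suc (2 * k)))
     * (\<Prod>j=1..k. (u - v * of_real q ^ j) * (v - u * of_real q ^ j))"

lemma prod_centred:
  fixes f :: "nat \<Rightarrow> 'a :: comm_monoid_mult"
  shows "(\<Prod>j<Suc (2 * k). f j) = f k * (\<Prod>i=1..k. f (k + i) * f (k - i))"
proof -
  have "m \<le> k \<Longrightarrow> (\<Prod>j=k-m..k+m. f j) = f k * (\<Prod>i=1..m. f (k + i) * f (k - i))" for m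
  proof (induction m)
    case (Suc m)
    have "{k - Suc m..k + Suc m} = insert (k - Suc m) (insert (k + Suc m) {k - m..k + m})"
      using Suc.prems by auto
    moreover have "k - Suc m \<notin> insert (k + Suc m) {k - m..k + m}" "k + Suc m \<notin> {k - m..k + m}"
      using Suc.prems by auto
    ultimately show ?case using Suc by (simp add: mult_ac)
  qed simp
  from this[of k] show ?thesis
    by (simp add: atLeast0AtMost lessThan_Suc_atMost mult_2)
qed

text \<open>
  With \<open>x = u * q^k\<close>, the factors \<open>x - v * q^j\<close> for \<open>j > k\<close>, \<open>j = k\<close> and
  \<open>j < k\<close> are multiples of \<open>u - v * q^(j-k)\<close>, \<open>u - v\<close> and \<open>v - u * q^(k-j)\<close>
  by signed powers of \<open>q\<close>. In this form the product needs no negative powers of \<open>q\<close>.\<close>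

lemma kernel_prod_expansion:
  fixes u v :: complex
  shows "(-1) ^ k * of_real q ^ (k * k + k + k * (k - 1) div 2)
      * ((u - v) * (\<Prod>j=1..k. (u - v * of_real q ^ j) * (v - u * of_real q ^ j)))
    = (\<Prod>j<Suc (2 * k). u * of_real q ^ k - v * of_real q ^ j)"
proof -
  define Q where "Q = complex_of_real q"
  have "(\<Prod>j<Suc (2 * k). u * Q ^ k - v * Q ^ j)
      = (u * Q ^ k - v * Q ^ k) * (\<Prod>i=1..k. (u * Q ^ k - v * Q ^ (k + i)) * (u * Q ^ k - v * Q ^ (k - i)))"
    by (rule prod_centred)
  also have "(\<Prod>i=1..k. (u * Q ^ k - v * Q ^ (k + i)) * (u * Q ^ k - v * Q ^ (k - i)))
      = (\<Prod>i=1..k. (- 1 * Q ^ k * Q ^ (k - i)) * ((u - v * Q ^ i) * (v - u * Q ^ i)))"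
  proof (rule prod.cong)
    fix i assume "i \<in> {1..k}"
    then have "Q ^ k = Q ^ (k - i) * Q ^ i" by (simp flip: power_add)
    then have "u * Q ^ k - v * Q ^ (k - i) = - 1 * Q ^ (k - i) * (v - u * Q ^ i)"
      by (simp add: algebra_simps)
    moreover have "u * Q ^ k - v * Q ^ (k + i) = Q ^ k * (u - v * Q ^ i)"
      by (simp add: power_add algebra_simps)
    ultimately show "(u * Q ^ k - v * Q ^ (k + i)) * (u * Q ^ k - v * Q ^ (k - i))
        = (- 1 * Q ^ k * Q ^ (k - i)) * ((u - v * Q ^ i) * (v - u * Q ^ i))"
      by (simp only: mult_ac)
  qed simp
  also have "\<dots> = ((- 1) ^ k * Q ^ (k * k) * (\<Prod>i=1..k. Q ^ (k - i)))
      * (\<Prod>i=1..k. (u - v * Q ^ i) * (v - u * Q ^ i))"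
    by (simp only: prod.distrib prod_constant card_atLeastAtMost diff_Suc_1 power_mult_distrib power_mult)
  also have "(\<Prod>i=1..k. Q ^ (k - i)) = Q ^ (k * (k - 1) div 2)"
  proof -
    have "(\<Prod>i=1..k. Q ^ (k - i)) = Q ^ (\<Sum>i=1..k. k - i)"
      by (rule power_sum[symmetric])
    also have "(\<Sum>i=1..k. k - i) = (\<Sum>i<k. i)"
      by (rule sum.reindex_bij_witness[of _ "\<lambda>i. k - i" "\<lambda>i. k - i"]) auto
    also have "\<dots> = k * (k - 1) div 2"
      by (cases k) (auto simp: lessThan_Suc_atMost gauss_sum_nat atLeast0AtMost[symmetric] mult.commute)
    finally show ?thesis .
  qed
  finally show ?thesis unfolding Q_def[symmetric]
    by (simp add: power_add algebra_simps)
qed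

text \<open>
  The right-hand side is the \<open>k\<close>-th diagonal of two Cauchy products. The first sum collects the
  terms of the \<open>q\<close>-binomial expansion with even powers \<open>2t\<close> of \<open>v\<close>, the second those with
  odd powers \<open>2t+1\<close>; with \<open>s = k - t\<close>, the powers of \<open>u\<close> are \<open>2s+1\<close> and \<open>2s\<close>. The diagonal structure
  rests on the exponent of \<open>q\<close> separating into a function of \<open>s\<close> plus a function of \<open>t\<close>,
  up to a factor common to all terms.\<close>

lemma kernel_term_expansion:
  fixes u v :: complex
  assumes q: "0 < q" "q < 1"
  shows "(u - v) * kernel_term q u v k
    = (\<Sum>t\<le>k. even_term q v t * odd_term q u (k - t)) - (\<Sum>t\<le>k. odd_term q v t * even_term q u (k - t))"
proof -
  define Q where "Q = complex_of_real q"
  have Q0: "Q \<noteq> 0" using q by (simp add: Q_def)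
  define h where "h b = complex_of_real ((-1) ^ b * q ^ (b * (b - 1) div 2) * gauss_binom q (Suc (2 * k)) b)
     * (u * Q ^ k) ^ (Suc (2 * k) - b) * v ^ b" for b
  define F where "F = complex_of_real (qq_poch q (Suc (2 * k)))"
  have F0: "F \<noteq> 0" using qq_poch_pos[OF q] by (simp add: F_def less_imp_neq[symmetric])
  have g: "complex_of_real (gauss_binom q (Suc (2 * k)) b) / F
      = 1 / (of_real (qq_poch q b) * of_real (qq_poch q (Suc (2 * k) - b)))" if "b \<le> Suc (2 * k)" for b
  proof -
    have "complex_of_real (gauss_binom q (Suc (2 * k)) b)
        * (of_real (qq_poch q b) * of_real (qq_poch q (Suc (2 * k) - b))) = F"
      unfolding F_def using gauss_binom_qq_poch[OF that, of q] by (metis of_real_mult)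
    then show ?thesis using F0 by (auto simp: field_simps)
  qed
  have even: "h (2 * t) / F = (-1) ^ k * Q ^ (k * k + k) * (even_term q v t * odd_term q u (k - t))"
    if "t \<le> k" for t
  proof -
    define s where "s = k - t"
    have k: "k = s + t" using that by (simp add: s_def)
    have sub: "Suc (2 * k) - 2 * t = Suc (2 * s)" by (simp add: k)
    \<comment> \<open>completing the square: the exponent is \<open>s\<^sup>2 + t * (t - 1)\<close> above the common \<open>k\<^sup>2 + k\<close>\<close>
    have "2 * t * (2 * t - 1) div 2 = t * (2 * t - 1)" by simp
    then have e: "2 * t * (2 * t - 1) div 2 + k * Suc (2 * s) = (k * k + k) + (s * s + t * (t - 1))"
      by (cases t) (auto simp: k algebra_simps)
    have e': "Q ^ (2 * t * (2 * t - 1) div 2) * (Q ^ k) ^ Suc (2 * s)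
        = Q ^ (k * k + k) * (Q ^ (s * s) * Q ^ (t * (t - 1)))"
      unfolding power_mult[symmetric] power_add[symmetric] e ..
    have sg: "(-1) ^ k * ((-1) ^ s * (-1) ^ t) = (1 :: complex)"
      by (cases "even s"; cases "even t") (simp_all add: k)
    have "h (2 * t) / F = (Q ^ (2 * t * (2 * t - 1) div 2) * (Q ^ k) ^ Suc (2 * s))
         * u ^ Suc (2 * s) * v ^ (2 * t)
         * (of_real (gauss_binom q (Suc (2 * k)) (2 * t)) / F)"
      unfolding h_def sub power_mult_distrib by (simp add: Q_def)
    also have "\<dots> = ((-1) ^ k * ((-1) ^ s * (-1) ^ t)) * (Q ^ (k * k + k) * (Q ^ (s * s) * Q ^ (t * (t - 1))))
         * u ^ Suc (2 * s) * v ^ (2 * t) * (1 / (of_real (qq_poch q (2 * t)) * of_real (qq_poch q (Suc (2 * s)))))"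
      using g[of "2 * t"] that unfolding e' sg sub by simp
    also have "\<dots> = (-1) ^ k * Q ^ (k * k + k) * (even_term q v t * odd_term q u s)"
      unfolding even_term_def odd_term_def Q_def[symmetric] of_real_mult of_real_divide of_real_power
        of_real_minus of_real_1
      by (simp add: field_simps)
    finally show ?thesis by (simp add: s_def)
  qed
  have odd: "h (Suc (2 * t)) / F = - ((-1) ^ k * Q ^ (k * k + k) * (odd_term q v t * even_term q u (k - t)))"
    if "t \<le> k" for t
  proof -
    define s where "s = k - t"
    have k: "k = s + t" using that by (simp add: s_def)
    have sub: "Suc (2 * k) - Suc (2 * t) = 2 * s" by (simp add: k)
    \<comment> \<open>here it is \<open>s * (s - 1) + t\<^sup>2\<close>: the roles of \<open>s\<close> and \<open>t\<close> are exchanged\<close>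
    have "Suc (2 * t) * (Suc (2 * t) - 1) = 2 * (t * Suc (2 * t))" by simp
    then have "Suc (2 * t) * (Suc (2 * t) - 1) div 2 = t * Suc (2 * t)" by linarith
    then have e: "Suc (2 * t) * (Suc (2 * t) - 1) div 2 + k * (2 * s) = (k * k + k) + (s * (s - 1) + t * t)"
      by (cases s) (auto simp: k algebra_simps)
    have e': "Q ^ (Suc (2 * t) * (Suc (2 * t) - 1) div 2) * (Q ^ k) ^ (2 * s)
        = Q ^ (k * k + k) * (Q ^ (s * (s - 1)) * Q ^ (t * t))"
      unfolding power_mult[symmetric] power_add[symmetric] e ..
    have sg: "(-1) ^ k * ((-1) ^ s * (-1) ^ t) = (1 :: complex)"
      by (cases "even s"; cases "even t") (simp_all add: k)
    have "h (Suc (2 * t)) / F = - ((Q ^ (Suc (2 * t) * (Suc (2 * t) - 1) div 2) * (Q ^ k) ^ (2 * s))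
         * u ^ (2 * s) * v ^ Suc (2 * t)
         * (of_real (gauss_binom q (Suc (2 * k)) (Suc (2 * t))) / F))"
      unfolding h_def sub power_mult_distrib by (simp add: Q_def del: gauss_binom.simps)
    also have "\<dots> = - (((-1) ^ k * ((-1) ^ s * (-1) ^ t)) * (Q ^ (k * k + k) * (Q ^ (s * (s - 1)) * Q ^ (t * t)))
         * u ^ (2 * s) * v ^ Suc (2 * t) * (1 / (of_real (qq_poch q (Suc (2 * t))) * of_real (qq_poch q (2 * s)))))"
      using g[of "Suc (2 * t)"] that unfolding e' sg sub by (simp del: gauss_binom.simps)
    also have "\<dots> = - ((-1) ^ k * Q ^ (k * k + k) * (odd_term q v t * even_term q u s))"
      unfolding even_term_def odd_term_def Q_def[symmetric] of_real_mult of_real_divide of_real_power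
        of_real_minus of_real_1
      by (simp add: field_simps)
    finally show ?thesis by (simp add: s_def)
  qed
  define W where "W = (\<Prod>j=1..k. (u - v * Q ^ j) * (v - u * Q ^ j))"
  have "((-1) ^ k * Q ^ (k * k + k)) * ((u - v) * kernel_term q u v k)
     = ((-1) ^ k * Q ^ (k * k + k + k * (k - 1) div 2) * ((u - v) * W)) / F"
    unfolding kernel_term_def W_def F_def Q_def by (simp add: power_add)
  also have "\<dots> = (\<Sum>b\<le>Suc (2 * k). h b) / F"
    unfolding h_def W_def Q_def kernel_prod_expansion q_binomial ..
  also have "\<dots> = (\<Sum>t\<le>k. h (2 * t) / F + h (Suc (2 * t)) / F)"
    unfolding sum.in_pairs_0 by (simp add: sum_divide_distrib add_divide_distrib)
  also have "\<dots> = (\<Sum>t\<le>k. ((-1) ^ k * Q ^ (k * k + k)) *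
       (even_term q v t * odd_term q u (k - t) - odd_term q v t * even_term q u (k - t)))"
    by (rule sum.cong) (simp_all only: even odd atMost_iff right_diff_distrib add_uminus_conv_diff)
  also have "\<dots> = ((-1) ^ k * Q ^ (k * k + k)) *
      ((\<Sum>t\<le>k. even_term q v t * odd_term q u (k - t)) - (\<Sum>t\<le>k. odd_term q v t * even_term q u (k - t)))"
    by (simp only: right_diff_distrib sum_distrib_left sum_subtractf)
  finally show ?thesis using Q0 by (simp del: power_Suc)
qed

section \<open>Bounds and limits\<close>

context
  fixes q :: real
  assumes q: "0 < q" "q < 1"
begin

lemma inverse_qq_poch_Suc_Suc: "1 / qq_poch q (Suc (Suc m)) \<le> 1 / (1 - q)\<^sup>2 * (1 / qq_poch q m)"
proof -
  have "(1 - q) * (1 - q) \<le> (1 - q ^ Suc m) * (1 - q ^ Suc (Suc m))"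
    by (intro mult_mono) (use q_Suc_bounds[OF q] q in \<open>auto simp del: power_Suc intro: less_imp_le\<close>)
  then have "(1 - q)\<^sup>2 * qq_poch q m \<le> qq_poch q (Suc (Suc m))"
    using qq_poch_pos[OF q, of m] by (simp add: qq_poch_Suc power2_eq_square mult_ac del: power_Suc)
  moreover have "0 < (1 - q)\<^sup>2 * qq_poch q m" using q qq_poch_pos[OF q, of m] by simp
  ultimately have "1 / qq_poch q (Suc (Suc m)) \<le> 1 / ((1 - q)\<^sup>2 * qq_poch q m)"
    by (intro divide_left_mono) (auto intro: mult_pos_pos qq_poch_pos[OF q])
  then show ?thesis by simp
qed

text \<open>
  The three majorants needed later differ only in the exponent of \<open>q\<close> and in the shifts \<open>i\<close> and \<open>j\<close>.
  Growth of the exponent by at least \<open>t\<close> per step outweighs every power of \<open>R\<close> and the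
  denominators.\<close>

lemma summable_q_series:
  fixes e :: "nat \<Rightarrow> nat" and R :: real
  assumes e: "\<And>t. e t + t \<le> e (Suc t)" and R: "0 \<le> R"
  shows "summable (\<lambda>t. q ^ e t / qq_poch q (2 * t + j) * R ^ (2 * t + i))"
proof (rule summable_if_ratio_le_geometric[OF q])
  fix t
  have qp: "0 \<le> q ^ e t / qq_poch q (2 * t + j) * R ^ (2 * t + i)" for t
    using q R qq_poch_pos[OF q] by (simp add: less_imp_le)
  have "q ^ e (Suc t) \<le> q ^ (e t + t)"
    by (rule power_decreasing) (use e q in auto)
  then have 1: "q ^ e (Suc t) \<le> q ^ e t * q ^ t" by (simp add: power_add)
  have 2: "1 / qq_poch q (2 * Suc t + j) \<le> 1 / (1 - q)\<^sup>2 * (1 / qq_poch q (2 * t + j))"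
    using inverse_qq_poch_Suc_Suc[of "2 * t + j"] by simp
  have "q ^ e (Suc t) * (1 / qq_poch q (2 * Suc t + j)) \<le> q ^ e t * q ^ t * (1 / (1 - q)\<^sup>2 * (1 / qq_poch q (2 * t + j)))"
    by (intro mult_mono 1 2) (use q qq_poch_pos[OF q] in \<open>auto intro!: divide_nonneg_pos simp: less_imp_le\<close>)
  then have "q ^ e (Suc t) * (1 / qq_poch q (2 * Suc t + j)) * R ^ (2 * Suc t + i)
      \<le> q ^ e t * q ^ t * (1 / (1 - q)\<^sup>2 * (1 / qq_poch q (2 * t + j))) * R ^ (2 * Suc t + i)"
    by (rule mult_right_mono) (use R in simp)
  then have "q ^ e (Suc t) / qq_poch q (2 * Suc t + j) * R ^ (2 * Suc t + i)
      \<le> R\<^sup>2 / (1 - q)\<^sup>2 * q ^ t * (q ^ e t / qq_poch q (2 * t + j) * R ^ (2 * t + i))"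
    by (simp add: power_add power2_eq_square mult_ac)
  then show "norm (q ^ e (Suc t) / qq_poch q (2 * Suc t + j) * R ^ (2 * Suc t + i))
      \<le> R\<^sup>2 / (1 - q)\<^sup>2 * q ^ t * norm (q ^ e t / qq_poch q (2 * t + j) * R ^ (2 * t + i))"
    using qp[of t] qp[of "Suc t"] by (simp only: real_norm_def abs_of_nonneg)
qed

lemma summable_majorants:
  assumes "0 \<le> R"
  shows "summable (\<lambda>t. q ^ (t * (t - 1)) / qq_poch q (2 * t) * R ^ (2 * t))"
    and "summable (\<lambda>t. q ^ (t * t) / qq_poch q (Suc (2 * t)) * R ^ Suc (2 * t))"
    and "summable (\<lambda>t. q ^ (t * (t - 1) div 2) / qq_poch q (Suc (2 * t)) * R ^ (2 * t))"
proof -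
  have "t * (t - 1) + t \<le> Suc t * (Suc t - 1)" for t :: nat by (cases t) auto
  moreover have "t * (t - 1) div 2 + t \<le> Suc t * (Suc t - 1) div 2" for t :: nat
  proof -
    have "Suc t * t = t * (t - 1) + t * 2" by (cases t) auto
    then have "Suc t * t div 2 = t * (t - 1) div 2 + t" by simp
    then show ?thesis by (simp only: diff_Suc_1)
  qed
  ultimately show "summable (\<lambda>t. q ^ (t * (t - 1)) / qq_poch q (2 * t) * R ^ (2 * t))"
    and "summable (\<lambda>t. q ^ (t * (t - 1) div 2) / qq_poch q (Suc (2 * t)) * R ^ (2 * t))"
    using summable_q_series[of "\<lambda>t. t * (t - 1)" R 0 0] 
      summable_q_series[of "\<lambda>t. t * (t - 1) div 2" R 1 0] assms by simp_all
  show "summable (\<lambda>t. q ^ (t * t) / qq_poch q (Suc (2 * t)) * R ^ Suc (2 * t))"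
    using summable_q_series[of "\<lambda>t. t * t" R 1 1] assms by simp
qed

text \<open>
  The majorants do not depend on the index of the polynomial, so they bound all rescaled
  polynomials on the disc of radius \<open>R\<close> simultaneously and also serve as the dominating series in
  Tannery's theorem.\<close>

lemma norm_even_coeff_le:
  assumes "norm x \<le> R"
  shows "norm (complex_of_real ((-1) ^ t * q ^ (t * (t - 1)) * gauss_binom q n (2 * t)) * x ^ (2 * t))
    \<le> q ^ (t * (t - 1)) / qq_poch q (2 * t) * R ^ (2 * t)"
proof -
  have "norm (complex_of_real ((-1) ^ t * q ^ (t * (t - 1)) * gauss_binom q n (2 * t)) * x ^ (2 * t))
      = q ^ (t * (t - 1)) * gauss_binom q n (2 * t) * norm x ^ (2 * t)"
    using q gauss_binom_nonneg[OF q] by (simp add: norm_mult norm_power abs_mult power_abs del: of_real_mult)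
  also have "\<dots> \<le> q ^ (t * (t - 1)) * (1 / qq_poch q (2 * t)) * R ^ (2 * t)"
    using q assms gauss_binom_le[OF q] gauss_binom_nonneg[OF q] qq_poch_pos[OF q]
    by (intro mult_mono power_mono mult_nonneg_nonneg) (auto simp: less_imp_le)
  finally show ?thesis by simp
qed

lemma norm_odd_coeff_le:
  assumes "norm x \<le> R"
  shows "norm (complex_of_real ((-1) ^ t * q ^ (t * t) * gauss_binom q n (Suc (2 * t))) * x ^ Suc (2 * t))
    \<le> q ^ (t * t) / qq_poch q (Suc (2 * t)) * R ^ Suc (2 * t)"
proof -
  have "norm (complex_of_real ((-1) ^ t * q ^ (t * t) * gauss_binom q n (Suc (2 * t))) * x ^ Suc (2 * t))
      = q ^ (t * t) * gauss_binom q n (Suc (2 * t)) * norm x ^ Suc (2 * t)"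
    using q gauss_binom_nonneg[OF q] by (simp add: norm_mult norm_power abs_mult power_abs del: of_real_mult)
  also have "\<dots> \<le> q ^ (t * t) * (1 / qq_poch q (Suc (2 * t))) * R ^ Suc (2 * t)"
    using q assms gauss_binom_le[OF q] gauss_binom_nonneg[OF q] qq_poch_pos[OF q] order_trans[OF norm_ge_zero assms]
    by (intro mult_mono power_mono mult_nonneg_nonneg) (auto simp: less_imp_le)
  finally show ?thesis by simp
qed

lemma norm_red_bounded:
  "\<exists>M. \<forall>n x. norm x \<le> R \<longrightarrow> norm (even_red q n x) \<le> M \<and> norm (odd_red q n x) \<le> M"
proof -
  define A where "A t = q ^ (t * (t - 1)) / qq_poch q (2 * t) * R ^ (2 * t)" for t
  define B where "B t = q ^ (t * t) / qq_poch q (Suc (2 * t)) * R ^ Suc (2 * t)" for t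
  show ?thesis
  proof (intro exI[of _ "max (suminf A) (suminf B)"] allI impI conjI)
    fix n x assume x: "norm (x :: complex) \<le> R"
    then have R: "0 \<le> R" using norm_ge_zero order_trans by blast
    have "0 \<le> A t" "0 \<le> B t" for t
      using q R qq_poch_pos[OF q] by (simp_all add: A_def B_def less_imp_le)
    moreover have "summable A" "summable B"
      unfolding A_def B_def by (rule summable_majorants[OF R])+
    ultimately have sA: "(\<Sum>t\<le>n. A t) \<le> suminf A" and sB: "(\<Sum>t\<le>n. B t) \<le> suminf B"
      by (auto intro!: sum_le_suminf)
    have "norm (even_red q n x) \<le> (\<Sum>t\<le>n. A t)"
      using even_odd_red_explicit[OF q(1) order_refl[of n], of x] norm_even_coeff_le[OF x]
      by (auto simp: A_def intro!: sum_norm_le simp del: of_real_mult)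
    then show "norm (even_red q n x) \<le> max (suminf A) (suminf B)" using sA by simp
    have "norm (odd_red q n x) \<le> (\<Sum>t\<le>n. B t)"
      using even_odd_red_explicit[OF q(1) order_refl[of n], of x] norm_odd_coeff_le[OF x]
      by (auto simp: B_def intro!: sum_norm_le simp del: of_real_mult gauss_binom.simps power_Suc)
    then show "norm (odd_red q n x) \<le> max (suminf A) (suminf B)" using sB by simp
  qed
qed

text \<open>
  Coefficientwise convergence of the Gaussian binomials to \<open>1 / (q;q)\<^sub>2\<^sub>t\<close>, passed through the sum by
  domination.\<close>

lemma even_red_LIMSEQ:
  "summable (\<lambda>t. norm (even_term q x t))" "(\<lambda>n. even_red q n x) \<longlonglongrightarrow> (\<Sum>t. even_term q x t)"
proof -
  define a where "a t n = complex_of_real ((-1) ^ t * q ^ (t * (t - 1)) * gauss_binom q (n + t) (2 * t))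
      * x ^ (2 * t)" for t n
  have "(\<lambda>n. (-1) ^ t * q ^ (t * (t - 1)) * gauss_binom q (n + t) (2 * t))
      \<longlonglongrightarrow> (-1) ^ t * q ^ (t * (t - 1)) * (1 / qq_poch q (2 * t))" for t
    by (intro tendsto_intros LIMSEQ_ignore_initial_segment gauss_binom_LIMSEQ q)
  then have "a t \<longlonglongrightarrow> of_real ((-1) ^ t * q ^ (t * (t - 1)) * (1 / qq_poch q (2 * t))) * x ^ (2 * t)" for t
    unfolding a_def by (rule tendsto_mult[OF tendsto_of_real tendsto_const])
  then have lim: "a t \<longlonglongrightarrow> even_term q x t" for t
    by (simp add: even_term_def)
  have "norm (a t n) \<le> q ^ (t * (t - 1)) / qq_poch q (2 * t) * norm x ^ (2 * t)" for t n
    unfolding a_def by (rule norm_even_coeff_le) simp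
  then have ev: "\<forall>\<^sub>F (t, n) in at_top \<times>\<^sub>F sequentially.
      norm (a t n) \<le> q ^ (t * (t - 1)) / qq_poch q (2 * t) * norm x ^ (2 * t)"
    by (intro always_eventually) auto
  have *: "summable (\<lambda>t. norm (even_term q x t)) \<and> (\<lambda>n. suminf (\<lambda>t. a t n)) \<longlonglongrightarrow> suminf (even_term q x)"
    using tannerys_theorem[OF lim ev summable_majorants(1)] by simp
  have "suminf (\<lambda>t. a t n) = even_red q n x" for n
    using even_odd_red_explicit[OF q(1) order_refl[of n], of x]
    by (subst suminf_finite[of "{..n}"]) (auto simp: a_def gauss_binom_eq_0)
  with * show "summable (\<lambda>t. norm (even_term q x t))" "(\<lambda>n. even_red q n x) \<longlonglongrightarrow> (\<Sum>t. even_term q x t)"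
    by auto
qed

lemma odd_red_LIMSEQ:
  "summable (\<lambda>t. norm (odd_term q x t))" "(\<lambda>n. odd_red q n x) \<longlonglongrightarrow> (\<Sum>t. odd_term q x t)"
proof -
  define a where "a t n = complex_of_real ((-1) ^ t * q ^ (t * t) * gauss_binom q (Suc (n + t)) (Suc (2 * t)))
      * x ^ Suc (2 * t)" for t n
  have "(\<lambda>n. gauss_binom q (Suc (n + t)) k) \<longlonglongrightarrow> 1 / qq_poch q k" for t k
    using LIMSEQ_ignore_initial_segment[OF gauss_binom_LIMSEQ[OF q, of k], of "Suc t"] by simp
  then have "(\<lambda>n. (-1) ^ t * q ^ (t * t) * gauss_binom q (Suc (n + t)) (Suc (2 * t)))
      \<longlonglongrightarrow> (-1) ^ t * q ^ (t * t) * (1 / qq_poch q (Suc (2 * t)))" for t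
    by (intro tendsto_intros)
  then have "a t \<longlonglongrightarrow> of_real ((-1) ^ t * q ^ (t * t) * (1 / qq_poch q (Suc (2 * t)))) * x ^ Suc (2 * t)" for t
    unfolding a_def by (rule tendsto_mult[OF tendsto_of_real tendsto_const])
  then have lim: "a t \<longlonglongrightarrow> odd_term q x t" for t
    by (simp add: odd_term_def)
  have "norm (a t n) \<le> q ^ (t * t) / qq_poch q (Suc (2 * t)) * norm x ^ Suc (2 * t)" for t n
    unfolding a_def by (rule norm_odd_coeff_le) simp
  then have ev: "\<forall>\<^sub>F (t, n) in at_top \<times>\<^sub>F sequentially.
      norm (a t n) \<le> q ^ (t * t) / qq_poch q (Suc (2 * t)) * norm x ^ Suc (2 * t)"
    by (intro always_eventually) auto
  have *: "summable (\<lambda>t. norm (odd_term q x t)) \<and> (\<lambda>n. suminf (\<lambda>t. a t n)) \<longlonglongrightarrow> suminf (odd_term q x)"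
    using tannerys_theorem[OF lim ev summable_majorants(2)] by simp
  have "suminf (\<lambda>t. a t n) = odd_red q n x" for n
    using even_odd_red_explicit[OF q(1) order_refl[of n], of x]
    by (subst suminf_finite[of "{..n}"]) (auto simp: a_def gauss_binom_eq_0 simp del: gauss_binom.simps)
  with * show "summable (\<lambda>t. norm (odd_term q x t))" "(\<lambda>n. odd_red q n x) \<longlonglongrightarrow> (\<Sum>t. odd_term q x t)"
    by auto
qed

text \<open>
  Undoing the rescaling, products of two polynomials of index \<open>i\<close> decay like \<open>q^(i div 2)\<close>,
  uniformly on discs. This gives both the convergence of the kernel and its continuity.\<close>

lemma orth_P_prod_bound:
  "\<exists>M. \<forall>i u v. norm u \<le> R \<longrightarrow> norm v \<le> R \<longrightarrow>
     norm (poly (orth_P q i) u * poly (orth_P q i) v) \<le> M * q ^ (i div 2)"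
proof -
  obtain M where E: "\<And>n x. norm x \<le> R \<Longrightarrow> norm (even_red q n x) \<le> M"
    and O: "\<And>n x. norm x \<le> R \<Longrightarrow> norm (odd_red q n x) \<le> M"
    using norm_red_bounded[of R] by blast
  show ?thesis
  proof (intro exI[of _ "M * M"] allI impI)
    fix i and u v :: complex assume u: "norm u \<le> R" and v: "norm v \<le> R"
    have M: "0 \<le> M" using E[OF u] norm_ge_zero order_trans by blast
    show "norm (poly (orth_P q i) u * poly (orth_P q i) v) \<le> M * M * q ^ (i div 2)"
    proof (cases "even i")
      case True
      then obtain m where i: "i = 2 * m" by blast
      have "norm (poly (orth_P q i) u * poly (orth_P q i) v) = q ^ m * (norm (even_red q m u) * norm (even_red q m v))"
        unfolding i orth_P_even_prod[OF q(1)] using q by (simp add: norm_mult norm_power)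
      also have "\<dots> \<le> q ^ m * (M * M)"
        by (intro mult_left_mono mult_mono E u v M) (use q in auto)
      finally show ?thesis by (simp add: i mult_ac)
    next
      case False
      then obtain m where i: "i = Suc (2 * m)" by (metis oddE Suc_eq_plus1)
      have "norm (poly (orth_P q i) u * poly (orth_P q i) v) = q ^ m * (norm (odd_red q m u) * norm (odd_red q m v))"
        unfolding i orth_P_odd_prod[OF q(1)] using q by (simp add: norm_mult norm_power)
      also have "\<dots> \<le> q ^ m * (M * M)"
        by (intro mult_left_mono mult_mono O u v M) (use q in auto)
      finally show ?thesis by (simp add: i mult_ac)
    qed
  qed
qed

lemma summable_power_div_2: "summable (\<lambda>i. q ^ (i div 2))"
proof (rule summable_comparison_test')
  show "summable (\<lambda>i. sqrt q ^ i / sqrt q)"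
    using q by (intro summable_divide summable_geometric) auto
  fix i :: nat
  \<comment> \<open>for odd \<open>i\<close> the truncation in \<open>i div 2\<close> loses a factor \<open>sqrt q\<close>, hence the denominator\<close>
  have s: "0 < sqrt q" "sqrt q < 1" "sqrt q * sqrt q = q" using q by auto
  have "sqrt q ^ (2 * m) = q ^ m" for m using s by (simp add: power_mult power2_eq_square)
  then have "q ^ (i div 2) * sqrt q \<le> sqrt q ^ i"
    using q s by (cases "even i") (auto elim!: evenE oddE simp: mult_left_le)
  then show "norm (q ^ (i div 2)) \<le> sqrt q ^ i / sqrt q"
    using q s by (simp add: field_simps)
qed

lemma norm_kernel_term_le:
  assumes "norm u \<le> R" "norm v \<le> R"
  shows "norm (kernel_term q u v k) \<le> q ^ (k * (k - 1) div 2) / qq_poch q (Suc (2 * k)) * (2 * R) ^ (2 * k)"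
proof -
  have f: "norm (x - y * of_real q ^ j) \<le> 2 * R" if "norm x \<le> R" "norm y \<le> R" for x y :: complex and j
  proof -
    have "norm (x - y * of_real q ^ j) \<le> norm x + norm y * q ^ j"
      using norm_triangle_ineq4[of x "y * of_real q ^ j"] q by (simp add: norm_mult norm_power)
    also have "norm y * q ^ j \<le> norm y * 1" by (intro mult_left_mono power_le_one) (use q in auto)
    finally show ?thesis using that by simp
  qed
  have R: "0 \<le> R" using assms(1) norm_ge_zero order_trans by blast
  have "norm (\<Prod>j=1..k. (u - v * of_real q ^ j) * (v - u * of_real q ^ j)) \<le> (\<Prod>j=1..k. (2 * R) * (2 * R))"
    unfolding prod_norm[symmetric] norm_mult
    by (intro prod_mono conjI mult_mono f assms mult_nonneg_nonneg norm_ge_zero) (use R in simp_all)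
  also have "\<dots> = (2 * R) ^ (2 * k)" by (simp add: power_mult power2_eq_square)
  finally show ?thesis
    unfolding kernel_term_def norm_mult norm_of_real using q qq_poch_pos[OF q, of "Suc (2 * k)"]
    by (intro mult_mono) auto
qed

lemma summable_orth_P_prod: "summable (\<lambda>n. poly (orth_P q n) u * poly (orth_P q n) v)"
proof -
  obtain M where M: "\<And>i u' v'. norm u' \<le> max (norm u) (norm v) \<Longrightarrow> norm v' \<le> max (norm u) (norm v) \<Longrightarrow>
     norm (poly (orth_P q i) u' * poly (orth_P q i) v') \<le> M * q ^ (i div 2)"
    using orth_P_prod_bound[of "max (norm u) (norm v)"] by blast
  show ?thesis
    by (rule summable_comparison_test'[OF summable_mult[OF summable_power_div_2]]) (rule M; simp)
qed

lemma summable_kernel_term: "summable (kernel_term q u v)"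
  by (rule summable_comparison_test'[OF summable_majorants(3) norm_kernel_term_le[of u "max (norm u) (norm v)"]])
     (auto simp: le_max_iff_disj)

section \<open>The kernel formula\<close>

text \<open>
  Along the partial sums with an odd number of terms, the Christoffel--Darboux formula identifies
  \<open>(u - v)\<close> times the kernel with the same combination of the limit functions that the Cauchy
  products of their series produce. Cancelling \<open>u - v\<close> is the step that excludes the diagonal.\<close>

lemma repr_kernel_off_diagonal:
  assumes "u \<noteq> v"
  shows "repr_kernel q u v = (\<Sum>k. kernel_term q u v k)"
proof -
  have sub: "strict_mono (\<lambda>n. Suc (2 * n))" by (auto simp: strict_mono_def)
  have "(\<lambda>n. \<Sum>i<n. poly (orth_P q i) u * poly (orth_P q i) v) \<longlonglongrightarrow> repr_kernel q u v"
    unfolding repr_kernel_def by (rule summable_LIMSEQ summable_orth_P_prod)+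
  from LIMSEQ_subseq_LIMSEQ[OF this sub]
  have "(\<lambda>n. (u - v) * (\<Sum>i<Suc (2 * n). poly (orth_P q i) u * poly (orth_P q i) v))
      \<longlonglongrightarrow> (u - v) * repr_kernel q u v"
    by (intro tendsto_intros) (simp add: o_def)
  then have "(\<lambda>n. odd_red q n u * even_red q n v - even_red q n u * odd_red q n v)
      \<longlonglongrightarrow> (u - v) * repr_kernel q u v"
    unfolding Christoffel_Darboux_red[OF q(1)] .
  moreover have "(\<lambda>n. odd_red q n u * even_red q n v - even_red q n u * odd_red q n v)
      \<longlonglongrightarrow> suminf (odd_term q u) * suminf (even_term q v) - suminf (even_term q u) * suminf (odd_term q v)"
    by (intro tendsto_intros even_red_LIMSEQ odd_red_LIMSEQ)
  ultimately have "(u - v) * repr_kernel q u v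
      = suminf (even_term q v) * suminf (odd_term q u) - suminf (odd_term q v) * suminf (even_term q u)"
    using LIMSEQ_unique by (metis (no_types, lifting) mult.commute)
  moreover have "(\<lambda>k. (u - v) * kernel_term q u v k) sums
      (suminf (even_term q v) * suminf (odd_term q u) - suminf (odd_term q v) * suminf (even_term q u))"
    unfolding kernel_term_expansion[OF q]
    by (intro sums_diff Cauchy_product_sums even_red_LIMSEQ(1) odd_red_LIMSEQ(1))
  moreover have "(\<lambda>k. (u - v) * kernel_term q u v k) sums ((u - v) * (\<Sum>k. kernel_term q u v k))"
    by (intro sums_mult summable_sums summable_kernel_term)
  ultimately have "(u - v) * repr_kernel q u v = (u - v) * (\<Sum>k. kernel_term q u v k)"
    using sums_unique2 by metis
  then show ?thesis using assms by simp
qed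

text \<open>
  The diagonal values follow by continuity in the first variable, obtained on a disc around
  the origin that contains \<open>v\<close>.\<close>

lemma repr_kernel_eq_suminf: "repr_kernel q u v = (\<Sum>k. kernel_term q u v k)"
proof (cases "u = v")
  case True
  define S where "S = ball (0 :: complex) (norm v + 1)"
  have vS: "v \<in> S" and S: "open S" by (auto simp: S_def)
  obtain M where M: "\<And>i x y. norm x \<le> norm v + 1 \<Longrightarrow> norm y \<le> norm v + 1 \<Longrightarrow>
     norm (poly (orth_P q i) x * poly (orth_P q i) y) \<le> M * q ^ (i div 2)"
    using orth_P_prod_bound[of "norm v + 1"] by blast
  have "uniform_limit S (\<lambda>n x. \<Sum>i<n. poly (orth_P q i) x * poly (orth_P q i) v)
      (\<lambda>x. repr_kernel q x v) sequentially"
    unfolding repr_kernel_def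
    by (rule Weierstrass_m_test[OF _ summable_mult[OF summable_power_div_2]], rule M) (auto simp: S_def)
  then have c1: "continuous_on S (\<lambda>x. repr_kernel q x v)"
    by (rule uniform_limit_theorem[rotated]) (auto intro!: always_eventually continuous_intros)
  have "uniform_limit S (\<lambda>n x. \<Sum>k<n. kernel_term q x v k) (\<lambda>x. \<Sum>k. kernel_term q x v k) sequentially"
    by (rule Weierstrass_m_test[OF norm_kernel_term_le[of _ "norm v + 1"] summable_majorants(3)]) (auto simp: S_def)
  then have c2: "continuous_on S (\<lambda>x. \<Sum>k. kernel_term q x v k)"
    by (rule uniform_limit_theorem[rotated])
       (auto intro!: always_eventually continuous_intros
          simp: kernel_term_def qq_poch_pos[OF q, THEN less_imp_neq, symmetric])
  have "isCont (\<lambda>x. repr_kernel q x v) v" "isCont (\<lambda>x. \<Sum>k. kernel_term q x v k) v"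
    using c1 c2 vS S continuous_on_eq_continuous_at by blast+
  then have l: "(\<lambda>x. repr_kernel q x v) \<midarrow>v\<rightarrow> repr_kernel q v v"
       "(\<lambda>x. \<Sum>k. kernel_term q x v k) \<midarrow>v\<rightarrow> (\<Sum>k. kernel_term q v v k)"
    by (simp_all add: isCont_def)
  have "\<forall>\<^sub>F x in at v. repr_kernel q x v = (\<Sum>k. kernel_term q x v k)"
    using repr_kernel_off_diagonal by (auto simp: eventually_at_filter)
  then have "(\<lambda>x. \<Sum>k. kernel_term q x v k) \<midarrow>v\<rightarrow> repr_kernel q v v"
    using l(1) by (rule Lim_transform_eventually[rotated])
  then show ?thesis using l(2) True by (metis LIM_unique)
qed (rule repr_kernel_off_diagonal)

text \<open>
  The pairs \<open>\<plusminus>q powr (3/2)\<close> and \<open>\<plusminus>q\<close> give differences of squares, whose product over the first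
  \<open>k\<close> indices interleaves odd and even exponents to \<open>(1 - q^2) * \<dots> * (1 - q^(2k+1))\<close>; the last
  factor \<open>1 - q\<close> supplies the missing first one.\<close>

lemma q_poch_denominator:
  "q_poch (of_real (q powr (3/2))) (of_real q) k * q_poch (- of_real (q powr (3/2))) (of_real q) k
     * q_poch (- of_real q) (of_real q) k * q_poch (of_real q) (of_real q) k * (1 - of_real q)
   = of_real (qq_poch q (Suc (2 * k)))"
proof (induction k)
  case 0
  then show ?case by (simp add: q_poch_def qq_poch_Suc)
next
  case (Suc k)
  define c where "c = complex_of_real (q powr (3/2))"
  define Q where "Q = complex_of_real q"
  have "q powr (3/2) * q powr (3/2) = q ^ 3"
    using q by (simp flip: powr_add)
  then have c: "c * c = Q ^ 3" unfolding c_def Q_def by (metis of_real_mult of_real_power)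
  have f: "(1 - c * Q ^ k) * (1 - - c * Q ^ k) * (1 - - Q * Q ^ k) * (1 - Q * Q ^ k)
      = (1 - Q ^ Suc (Suc (2 * k))) * (1 - Q ^ Suc (Suc (Suc (2 * k))))"
  proof -
    have "(1 - c * Q ^ k) * (1 - - c * Q ^ k) = 1 - c * c * (Q ^ k * Q ^ k)" by (simp add: algebra_simps)
    also have "\<dots> = 1 - Q ^ Suc (Suc (Suc (2 * k)))"
      unfolding c by (simp add: power_add[symmetric] numeral_3_eq_3 mult_2)
    finally have 1: "(1 - c * Q ^ k) * (1 - - c * Q ^ k) = 1 - Q ^ Suc (Suc (Suc (2 * k)))" .
    have 2: "(1 - - Q * Q ^ k) * (1 - Q * Q ^ k) = 1 - Q ^ Suc (Suc (2 * k))"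
    proof -
      have "(1 - - Q * Q ^ k) * (1 - Q * Q ^ k) = 1 - Q * Q * (Q ^ k * Q ^ k)" by (simp add: algebra_simps)
      then show ?thesis by (simp add: power_add[symmetric] mult_2 mult.assoc)
    qed
    show ?thesis using 1 2 by (simp only: mult.assoc) (simp only: mult_ac)
  qed
  have r: "complex_of_real (qq_poch q (Suc (2 * Suc k)))
      = of_real (qq_poch q (Suc (2 * k))) * ((1 - Q ^ Suc (Suc (2 * k))) * (1 - Q ^ Suc (Suc (Suc (2 * k)))))"
    by (simp add: qq_poch_Suc Q_def del: power_Suc)
  have s: "q_poch a b (Suc k) = q_poch a b k * (1 - a * b ^ k)" for a b
    by (simp add: q_poch_def)
  show ?case
    unfolding s r Suc[symmetric] f[symmetric] c_def[symmetric] Q_def[symmetric] by (simp only: mult_ac)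
qed

lemma kernel_phi33_term_conv: "kernel_phi33_term q u v k = (1 - of_real q) * kernel_term q u v k"
proof -
  have nz: "1 - complex_of_real q \<noteq> 0"
    using q by (metis of_real_1 of_real_eq_iff less_irrefl right_minus_eq)
  have q0: "q_poch 0 x k = 1" for x by (simp add: q_poch_def)
  have s: "(-1) ^ k * (-1) ^ k = (1 :: complex)" by (cases "even k") simp_all
  have "kernel_phi33_term q u v k = (1 - of_real q) *
     (of_real q ^ (k * (k - 1) div 2) * (\<Prod>j=1..k. (u - v * of_real q ^ j) * (v - u * of_real q ^ j)))
     / (q_poch (of_real (q powr (3/2))) (of_real q) k * q_poch (- of_real (q powr (3/2))) (of_real q) k
     * q_poch (- of_real q) (of_real q) k * q_poch (of_real q) (of_real q) k * (1 - of_real q)) * ((-1) ^ k * (-1) ^ k)"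
    unfolding kernel_phi33_term_def q0 using nz by simp
  then show ?thesis unfolding q_poch_denominator s kernel_term_def by simp
qed

lemma repr_kernel_phi33:
  "summable (kernel_phi33_term q u v)"
  "repr_kernel q u v = 1 / (1 - of_real q) * (\<Sum>k. kernel_phi33_term q u v k)"
proof -
  have nz: "1 - complex_of_real q \<noteq> 0"
    using q by (metis of_real_1 of_real_eq_iff less_irrefl right_minus_eq)
  show "summable (kernel_phi33_term q u v)"
    unfolding kernel_phi33_term_conv by (intro summable_mult summable_kernel_term)
  show "repr_kernel q u v = 1 / (1 - of_real q) * (\<Sum>k. kernel_phi33_term q u v k)"
    unfolding kernel_phi33_term_conv suminf_mult[OF summable_kernel_term] repr_kernel_eq_suminf
    using nz by simp
qed

end

theorem theorem12:
  fixes q :: real and u v :: complex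
  assumes "0 < q" and "q < 1"
  shows "summable (\<lambda>n. poly (orth_P q n) u * poly (orth_P q n) v) \<and>
    (u \<noteq> 0 \<and> v \<noteq> 0 \<longrightarrow>
       summable (phi33_term 0 (inverse u * v * of_real q) (u * inverse v * of_real q)
         (of_real (q powr (3/2))) (- of_real (q powr (3/2))) (- of_real q) (of_real q) (- (u * v))) \<and>
       repr_kernel q u v = 1 / (1 - of_real q) *
         phi33 0 (inverse u * v * of_real q) (u * inverse v * of_real q)
           (of_real (q powr (3/2))) (- of_real (q powr (3/2))) (- of_real q) (of_real q) (- (u * v))) \<and>
    (u = 0 \<or> v = 0 \<longrightarrow>
       summable (kernel_phi33_term q u v) \<and>
       repr_kernel q u v = 1 / (1 - of_real q) * (\<Sum>k. kernel_phi33_term q u v k))"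
proof (intro conjI impI)
  show "summable (\<lambda>n. poly (orth_P q n) u * poly (orth_P q n) v)"
    by (rule summable_orth_P_prod[OF assms])
next
  assume uv: "u \<noteq> 0 \<and> v \<noteq> 0"
  have eq: "phi33_term 0 (inverse u * v * of_real q) (u * inverse v * of_real q)
      (of_real (q powr (3/2))) (- of_real (q powr (3/2))) (- of_real q) (of_real q) (- (u * v))
    = kernel_phi33_term q u v"
    by (rule ext, rule kernel_phi33_term_eq[symmetric]) (use uv in auto)
  show "summable (phi33_term 0 (inverse u * v * of_real q) (u * inverse v * of_real q)
         (of_real (q powr (3/2))) (- of_real (q powr (3/2))) (- of_real q) (of_real q) (- (u * v)))"
    unfolding eq by (rule repr_kernel_phi33(1)[OF assms])
  show "repr_kernel q u v = 1 / (1 - of_real q) *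
         phi33 0 (inverse u * v * of_real q) (u * inverse v * of_real q)
           (of_real (q powr (3/2))) (- of_real (q powr (3/2))) (- of_real q) (of_real q) (- (u * v))"
    unfolding phi33_def eq by (rule repr_kernel_phi33(2)[OF assms])
qed (rule repr_kernel_phi33[OF assms])+

end
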